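(* Let $a$, $b$, $n$ be complex parameters with $n\notin\{0,-1,-2,\ldots\}$, and let $f(n)$ denote the hypergeometric series $$ f(n)=\sum_{k=0}^{\infty}\frac{(a)_k\,(b)_k}{(n)_k^2}. $$ If the series $f(n)$ and $f(n+1)$ converge, and $(a+b-2n)(1+a+b-2n)\neq 0$, then $$ f(n) = \frac{a+b+ab-2(1+a+b)n+3n^2}{(a+b-2n)(1+a+b-2n)} + \frac{(a-n)^2(b-n)^2}{(a+b-2n)(1+a+b-2n)\,n^2}\, f(n+1). $$
   Context: For a complex number $x$ and an integer $k\ge 0$, $(x)_k = x(x+1)\cdots(x+k-1)$ denotes the Pochhammer symbol (rising factorial), with $(x)_0=1$, and $(x)_k^2$ means $((x)_k)^2$. Here $f(n+1)$ is the same series with $n$ replaced by $n+1$ and with $a,b$ unchanged, i.e. $f(n+1)=\sum_{k\ge 0}(a)_k(b)_k/(n+1)_k^2$. *)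

theory Defs
  imports "HOL-Analysis.Analysis"
begin

definition hyp_term :: "complex \<Rightarrow> complex \<Rightarrow> complex \<Rightarrow> nat \<Rightarrow> complex" where
  "hyp_term a b n k = pochhammer a k * pochhammer b k / (pochhammer n k)\<^sup>2"

(* The value is meaningful only when the terms are summable. *)
definition hyp_series :: "complex \<Rightarrow> complex \<Rightarrow> complex \<Rightarrow> complex" where
  "hyp_series a b n = (\<Sum>k. hyp_term a b n k)"

end

theory Submission
  imports Defs
begin

text \<open>
  The identity is a telescoping one (creative telescoping in \<open>n\<close>). Put \<open>\<alpha> = a - n\<close>,
  \<open>\<beta> = b - n\<close>, \<open>D = (\<alpha> + \<beta>) (\<alpha> + \<beta> + 1)\<close> and let \<open>t k\<close> be the \<open>k\<close>-th term of \<open>f(n)\<close>. The \<open>k\<close>-th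
  term of \<open>f(n + 1)\<close> is \<open>t k * n\<^sup>2 / (n + k)\<^sup>2\<close>, so \<open>D f(n) - \<alpha>\<^sup>2 \<beta>\<^sup>2 / n\<^sup>2 * f(n + 1)\<close> is the sum of
  \<open>t k * (D - \<alpha>\<^sup>2 \<beta>\<^sup>2 / (n + k)\<^sup>2)\<close>. This summand is the forward difference of
  \<open>G k = t k * P (n + k)\<close> for a linear polynomial \<open>P\<close> whose leading coefficient is \<open>\<alpha> + \<beta>\<close>
  (lemma \<open>hyp_term_telescope\<close>), and \<open>- G 0\<close> is the numerator of the rational summand in the claim.

  What remains is that \<open>G\<close> tends to zero. Since the series of differences converges, \<open>G\<close> has some
  limit. As \<open>t\<close> tends to zero and \<open>\<alpha> + \<beta> \<noteq> 0\<close>, the sequence \<open>k * t k\<close> then has a limit as well. A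
  nonzero limit would make \<open>t k\<close> comparable to the harmonic series, against the convergence of
  \<open>f(n)\<close> (lemma \<open>summable_imp_limit_times_index_zero\<close>).
\<close>

text \<open>
  Dividing by a nonzero limit makes it \<open>1\<close>; then the real parts of the terms are eventually at least
  \<open>1 / (2 k)\<close>. The comparison is made for real parts, not norms, because the series is not assumed
  to converge absolutely.
\<close>

lemma summable_imp_limit_times_index_zero:
  fixes f :: "nat \<Rightarrow> complex"
  assumes "summable f" and lim: "(\<lambda>k. of_nat k * f k) \<longlonglongrightarrow> L"
  shows "L = 0"
proof (rule ccontr)
  assume "L \<noteq> 0"
  have "(\<lambda>k. of_nat k * f k / L) \<longlonglongrightarrow> L / L"
    using lim \<open>L \<noteq> 0\<close> by (intro tendsto_divide) auto
  then have "(\<lambda>k. Re (of_nat k * f k / L)) \<longlonglongrightarrow> 1"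
    using tendsto_Re \<open>L \<noteq> 0\<close> by fastforce
  then have "\<forall>\<^sub>F k in sequentially. Re (of_nat k * f k / L) > 1 / 2"
    by (rule order_tendstoD) simp
  then have "\<forall>\<^sub>F k in sequentially. norm (inverse (real k)) \<le> 2 * Re (f k / L)"
    using eventually_gt_at_top[of 0]
  proof eventually_elim
    case (elim k)
    have "of_nat k * f k / L = of_real (real k) * (f k / L)"
      by simp
    then have "Re (of_nat k * f k / L) = real k * Re (f k / L)"
      by (simp only: Re_complex_of_real Im_complex_of_real times_complex.simps mult_zero_left diff_zero)
    then show ?case
      using elim by (simp add: field_simps)
  qed
  moreover have "summable (\<lambda>k. 2 * Re (f k / L))"
    using \<open>summable f\<close> by (intro summable_mult summable_Re summable_divide)
  ultimately have "summable (\<lambda>k. inverse (real k))"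
    by (rule summable_comparison_test_ev)
  then show False
    using not_summable_harmonic[where 'a = real] by simp
qed

lemma plus_of_nat_nonzero:
  fixes n :: complex
  assumes "n \<notin> \<int>\<^sub>\<le>\<^sub>0"
  shows "n + of_nat k \<noteq> 0"
  using assms by (metis add_eq_0_iff2 minus_of_nat_in_nonpos_Ints)

lemma hyp_term_Suc:
  "hyp_term a b n (Suc k)
    = hyp_term a b n k * ((a + of_nat k) * (b + of_nat k) / (n + of_nat k)\<^sup>2)"
  by (simp add: hyp_term_def pochhammer_Suc power_mult_distrib)

lemma hyp_term_shift:
  assumes "n \<notin> \<int>\<^sub>\<le>\<^sub>0"
  shows "hyp_term a b (n + 1) k = hyp_term a b n k * (n\<^sup>2 / (n + of_nat k)\<^sup>2)"
proof -
  have "n \<noteq> 0"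
    using assms by auto
  have "n * pochhammer (n + 1) k = pochhammer n k * (n + of_nat k)"
    by (simp flip: pochhammer_rec add: pochhammer_Suc)
  then have "pochhammer (n + 1) k = pochhammer n k * (n + of_nat k) / n"
    using \<open>n \<noteq> 0\<close> by (simp add: field_simps)
  then show ?thesis
    by (simp add: hyp_term_def power_mult_distrib power_divide)
qed

text \<open>
  With \<open>x = n + k\<close>, cancelling \<open>t k\<close> and clearing \<open>x\<^sup>2\<close> reduces the telescoping condition to
  \<open>P (x + 1) (x + \<alpha>) (x + \<beta>) - P x * x\<^sup>2 = D x\<^sup>2 - \<alpha>\<^sup>2 \<beta>\<^sup>2\<close>. For linear \<open>P\<close> the coefficients of
  \<open>x\<^sup>2\<close> and \<open>x\<close> force \<open>P x = (\<alpha> + \<beta>) (x - 1) - \<alpha> \<beta>\<close>, and the constant coefficients then agree.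
\<close>

lemma hyp_term_telescope:
  fixes a b n :: complex
  assumes "n \<notin> \<int>\<^sub>\<le>\<^sub>0"
  defines "G \<equiv> \<lambda>k. hyp_term a b n k * ((a + b - 2 * n) * (n + of_nat k - 1) - (a - n) * (b - n))"
  shows "G (Suc k) - G k
    = (a + b - 2 * n) * (1 + a + b - 2 * n) * hyp_term a b n k
      - (a - n)\<^sup>2 * (b - n)\<^sup>2 / n\<^sup>2 * hyp_term a b (n + 1) k"
proof -
  define x where "x = n + of_nat k"
  define t where "t = hyp_term a b n k"
  have "x \<noteq> 0"
    unfolding x_def using assms(1) by (rule plus_of_nat_nonzero)
  have "n \<noteq> 0"
    using assms(1) by auto
  have k: "of_nat k = x - n"
    by (simp add: x_def)
  have "((a + b - 2 * n) * x - (a - n) * (b - n)) * ((a + (x - n)) * (b + (x - n)))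
      - ((a + b - 2 * n) * (x - 1) - (a - n) * (b - n)) * x\<^sup>2
    = (a + b - 2 * n) * (1 + a + b - 2 * n) * x\<^sup>2 - (a - n)\<^sup>2 * (b - n)\<^sup>2"
    by algebra
  then have "t * (((a + b - 2 * n) * x - (a - n) * (b - n)) * ((a + (x - n)) * (b + (x - n)))
        - ((a + b - 2 * n) * (x - 1) - (a - n) * (b - n)) * x\<^sup>2) / x\<^sup>2
    = t * ((a + b - 2 * n) * (1 + a + b - 2 * n) * x\<^sup>2 - (a - n)\<^sup>2 * (b - n)\<^sup>2) / x\<^sup>2"
    by (simp only:)
  then have "t * ((a + (x - n)) * (b + (x - n)) / x\<^sup>2) * ((a + b - 2 * n) * x - (a - n) * (b - n))
      - t * ((a + b - 2 * n) * (x - 1) - (a - n) * (b - n))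
    = (a + b - 2 * n) * (1 + a + b - 2 * n) * t - (a - n)\<^sup>2 * (b - n)\<^sup>2 * (t / x\<^sup>2)"
    using \<open>x \<noteq> 0\<close> by (simp add: right_diff_distrib[of t] diff_divide_distrib mult_ac)
  moreover have "G (Suc k)
      = t * ((a + (x - n)) * (b + (x - n)) / x\<^sup>2) * ((a + b - 2 * n) * x - (a - n) * (b - n))"
    by (simp add: G_def hyp_term_Suc k t_def)
  moreover have "G k = t * ((a + b - 2 * n) * (x - 1) - (a - n) * (b - n))"
    by (simp add: G_def t_def x_def)
  moreover have "(a - n)\<^sup>2 * (b - n)\<^sup>2 / n\<^sup>2 * hyp_term a b (n + 1) k
      = (a - n)\<^sup>2 * (b - n)\<^sup>2 * (t / x\<^sup>2)"
    using \<open>n \<noteq> 0\<close> by (simp add: hyp_term_shift[OF assms(1)] t_def x_def)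
  ultimately show ?thesis
    by (simp only: t_def)
qed

theorem theorem4p1:
  fixes a b n :: complex
  assumes "n \<notin> \<int>\<^sub>\<le>\<^sub>0"
    and "summable (hyp_term a b n)"
    and "summable (hyp_term a b (n + 1))"
    and "(a + b - 2 * n) * (1 + a + b - 2 * n) \<noteq> 0"
  shows "hyp_series a b n =
      (a + b + a * b - 2 * (1 + a + b) * n + 3 * n\<^sup>2)
        / ((a + b - 2 * n) * (1 + a + b - 2 * n))
      + (a - n)\<^sup>2 * (b - n)\<^sup>2
        / ((a + b - 2 * n) * (1 + a + b - 2 * n) * n\<^sup>2) * hyp_series a b (n + 1)"
proof -
  define c where "c = a + b - 2 * n"
  define d where "d = c * (n - 1) - (a - n) * (b - n)"
  define D where "D = c * (1 + a + b - 2 * n)"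
  define E where "E = (a - n)\<^sup>2 * (b - n)\<^sup>2 / n\<^sup>2"
  define t where "t = hyp_term a b n"
  define G where "G k = t k * (c * (n + of_nat k - 1) - (a - n) * (b - n))" for k
  define S where "S = D * hyp_series a b n - E * hyp_series a b (n + 1)"
  have "c \<noteq> 0" "D \<noteq> 0"
    using assms(4) by (auto simp: c_def D_def)
  have step: "G (Suc k) - G k = D * hyp_term a b n k - E * hyp_term a b (n + 1) k" for k
    using hyp_term_telescope[OF assms(1), of a b k]
    by (simp only: G_def t_def c_def D_def E_def)
  have "(\<lambda>k. G (Suc k) - G k) sums S"
    unfolding step S_def hyp_series_def
    using assms(2,3) by (intro sums_diff sums_mult summable_sums)
  then have "(\<lambda>m. G m - G 0) \<longlonglongrightarrow> S"
    by (simp add: sums_def sum_lessThan_telescope)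
  then have "(\<lambda>m. G m - G 0 + G 0) \<longlonglongrightarrow> S + G 0"
    by (intro tendsto_add tendsto_const)
  then have G_lim: "G \<longlonglongrightarrow> S + G 0"
    by simp
  have "t \<longlonglongrightarrow> 0"
    unfolding t_def using assms(2) by (rule summable_LIMSEQ_zero)
  with G_lim have "(\<lambda>k. (G k - d * t k) / c) \<longlonglongrightarrow> (S + G 0 - d * 0) / c"
    using \<open>c \<noteq> 0\<close> by (intro tendsto_intros)
  moreover have "(G k - d * t k) / c = of_nat k * t k" for k
    using \<open>c \<noteq> 0\<close> by (simp add: G_def d_def field_simps)
  ultimately have "(\<lambda>k. of_nat k * t k) \<longlonglongrightarrow> (S + G 0) / c"
    by simp
  moreover have "summable t"
    unfolding t_def using assms(2) .
  ultimately have "(S + G 0) / c = 0"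
    using summable_imp_limit_times_index_zero by blast
  then have "S = - G 0"
    using \<open>c \<noteq> 0\<close> by (simp add: add_eq_0_iff2)
  also have "- G 0 = a + b + a * b - 2 * (1 + a + b) * n + 3 * n\<^sup>2"
    by (simp add: G_def t_def hyp_term_def c_def algebra_simps power2_eq_square)
  finally have "D * hyp_series a b n
      = (a + b + a * b - 2 * (1 + a + b) * n + 3 * n\<^sup>2) + E * hyp_series a b (n + 1)"
    by (simp add: S_def algebra_simps)
  then have "hyp_series a b n
      = ((a + b + a * b - 2 * (1 + a + b) * n + 3 * n\<^sup>2) + E * hyp_series a b (n + 1)) / D"
    using \<open>D \<noteq> 0\<close> by (simp add: eq_divide_eq mult.commute)
  then show ?thesis
    unfolding D_def E_def c_def by (simp add: add_divide_distrib mult_ac)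
qed

end
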